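(* Let $x\in\mathbb{R}^n$ satisfy $(L_f+L_G)\|x\|\leq\|G(0)^{-1}\|^{-1}$. Define $$\overline{\mathcal{V}}^{\mathcal{G}}_x=\mathbb{B}^n\left(f(0);\|G(0)^{-1}\|^{-1}-L_f\|x\|-L_G\|x\|\right).$$ Then $\overline{\mathcal{V}}^{\mathcal{G}}_x\subseteq\mathcal{V}^{\mathcal{G}}_x$.
   Context: Let $n\ge 1$. For vectors, $\|\cdot\|$ is the Euclidean norm; for matrices, $\|M\|=\max_{\|v\|=1}\|Mv\|$. $\mathbb{B}^n(c;r)$ is the closed ball in $\mathbb{R}^n$ with center $c$ and radius $r\ge 0$. For a vector $v$, matrix $M$ and set $\mathcal{S}$ of vectors, $v+M\mathcal{S}=\{v+Ms : s\in\mathcal{S}\}$. Setting: $\mathcal{U}=\mathbb{B}^n(0;1)$; $L_f,L_G\ge 0$ are real constants; $f:\mathbb{R}^n\to\mathbb{R}^n$ and $G:\mathbb{R}^n\to\mathbb{R}^{n\times n}$ satisfy $\|f(x)-f(y)\|\le L_f\|x-y\|$ and $\|G(x)-G(y)\|\le L_G\|x-y\|$ for all $x,y\in\mathbb{R}^n$, and $G(0)$ is invertible. $\mathcal{D}_{con}$ is the set of all pairs $(\hat f,\hat G)$ of functions $\hat f:\mathbb{R}^n\to\mathbb{R}^n$, $\hat G:\mathbb{R}^n\to\mathbb{R}^{n\times n}$ such that $\hat f(0)=f(0)$, $\hat G(0)=G(0)$, $\hat f$ is globally Lipschitz with constant $L_f$, and $\hat G$ is globally Lipschitz with constant $L_G$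 (in the norms above). The guaranteed velocity set at $x\in\mathbb{R}^n$ is $\mathcal{V}^{\mathcal{G}}_x=\bigcap_{(\hat f,\hat G)\in\mathcal{D}_{con}}\left(\hat f(x)+\hat G(x)\,\mathcal{U}\right)$. *)

theory Defs
  imports "HOL-Analysis.Analysis"
begin

text \<open>The library norm on \<^typ>\<open>real^'n^'m\<close> is the Frobenius norm; matrices are measured here
  in the operator norm induced by the Euclidean norm instead.\<close>

abbreviation mat_norm :: "real^'n^'m \<Rightarrow> real" where
  "mat_norm M \<equiv> onorm (\<lambda>v. M *v v)"

text \<open>\<^const>\<open>onorm\<close> is a supremum of quotients; it is the maximum over the unit sphere.\<close>

lemma mat_norm_is_max:
  fixes M :: "real^'n^'m"
  shows "\<exists>v. norm v = 1 \<and> norm (M *v v) = mat_norm M"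
    and "norm v = 1 \<Longrightarrow> norm (M *v v) \<le> mat_norm M"
proof -
  have bl: "bounded_linear (\<lambda>v. M *v v)"
    by (rule matrix_vector_mul_bounded_linear)
  show le: "norm (M *v v) \<le> mat_norm M" if "norm v = 1" for v
    using onorm[OF bl, of v] that by simp
  have "\<exists>u\<in>sphere 0 1. \<forall>w\<in>sphere (0::real^'n) 1. norm (M *v w) \<le> norm (M *v u)"
  proof (rule continuous_attains_sup)
    show "sphere (0::real^'n) 1 \<noteq> {}" by simp
    show "continuous_on (sphere 0 1) (\<lambda>w. norm (M *v w))"
      by (intro continuous_on_norm linear_continuous_on bl)
  qed simp
  then obtain u where u: "norm u = 1" and max: "\<And>w. norm w = 1 \<Longrightarrow> norm (M *v w) \<le> norm (M *v u)"
    by auto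
  have "mat_norm M \<le> norm (M *v u)"
  proof (rule onorm_bound)
    fix x :: "real^'n"
    show "norm (M *v x) \<le> norm (M *v u) * norm x"
    proof (cases "x = 0")
      case False
      then have "norm (M *v (x /\<^sub>R norm x)) \<le> norm (M *v u)"
        by (intro max) simp
      then show ?thesis
        using False by (simp add: matrix_vector_mult_scaleR field_simps)
    qed simp
  qed simp
  with le[OF u] u show "\<exists>v. norm v = 1 \<and> norm (M *v v) = mat_norm M"
    by (intro exI[of _ u]) simp
qed

definition mat_lipschitz :: "real \<Rightarrow> (real^'n \<Rightarrow> real^'n^'n) \<Rightarrow> bool" where
  "mat_lipschitz L G \<longleftrightarrow> 0 \<le> L \<and> (\<forall>x y. mat_norm (G x - G y) \<le> L * norm (x - y))"

definition D_con ::
  "real \<Rightarrow> real \<Rightarrow> (real^'n \<Rightarrow> real^'n) \<Rightarrow> (real^'n \<Rightarrow> real^'n^'n) \<Rightarrow>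
    ((real^'n \<Rightarrow> real^'n) \<times> (real^'n \<Rightarrow> real^'n^'n)) set" where
  "D_con Lf LG f G = {(f', G'). f' 0 = f 0 \<and> G' 0 = G 0 \<and>
     Lf-lipschitz_on UNIV f' \<and> mat_lipschitz LG G'}"

definition guaranteed_velocity_set ::
  "real \<Rightarrow> real \<Rightarrow> (real^'n \<Rightarrow> real^'n) \<Rightarrow> (real^'n \<Rightarrow> real^'n^'n) \<Rightarrow>
    real^'n \<Rightarrow> (real^'n) set" where
  "guaranteed_velocity_set Lf LG f G x =
     (\<Inter>(f', G') \<in> D_con Lf LG f G. (\<lambda>u. f' x + G' x *v u) ` cball 0 1)"

definition guaranteed_velocity_ball ::
  "real \<Rightarrow> real \<Rightarrow> (real^'n \<Rightarrow> real^'n) \<Rightarrow> (real^'n \<Rightarrow> real^'n^'n) \<Rightarrow>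
    real^'n \<Rightarrow> (real^'n) set" where
  "guaranteed_velocity_ball Lf LG f G x =
     cball (f 0) (inverse (mat_norm (matrix_inv (G 0))) - Lf * norm x - LG * norm x)"

end

theory Submission
  imports Defs
begin

text \<open>The matrix \<open>G 0\<close> expands norms by at least \<open>s = inverse (mat_norm (matrix_inv (G 0)))\<close>, and
  an admissible \<open>G' x\<close> differs from it by at most \<open>LG * norm x\<close> in operator norm, so \<open>G' x\<close>
  expands norms by at least \<open>r = s - LG * norm x\<close>. A square matrix with this property maps
  the unit ball onto a superset of the ball of radius \<open>r\<close>, and moving the centre from \<open>f 0\<close> to \<open>f' x\<close>
  costs at most \<open>Lf * norm x\<close>.\<close>

lemma mat_norm_mult_vec_le:
  fixes M :: "real^'n^'m"
  shows "norm (M *v v) \<le> mat_norm M * norm v"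
  by (rule onorm[OF matrix_vector_mul_bounded_linear])

text \<open>Apply the operator norm bound of the inverse to
  \<open>v = matrix_inv A *v (A *v v)\<close>.\<close>

lemma norm_mult_vec_ge_of_invertible:
  fixes A :: "real^'n^'n"
  assumes "invertible A"
  shows "inverse (mat_norm (matrix_inv A)) * norm v \<le> norm (A *v v)"
proof -
  have "matrix_inv A ** A = mat 1"
    using assms unfolding invertible_def matrix_inv_def by (rule someI2_ex) simp
  then have "matrix_inv A *v (A *v v) = v"
    by (simp add: matrix_vector_mul_assoc)
  then have le: "norm v \<le> mat_norm (matrix_inv A) * norm (A *v v)"
    by (metis mat_norm_mult_vec_le)
  have "0 \<le> mat_norm (matrix_inv A)"
    by (rule onorm_pos_le[OF matrix_vector_mul_bounded_linear])
  \<comment> \<open>If the norm of the inverse is 0, the convention \<open>inverse 0 = 0\<close>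
    makes the left side 0.\<close>
  with le show ?thesis
    by (cases "mat_norm (matrix_inv A) = 0") (auto simp: field_simps)
qed

lemma norm_mult_vec_ge_perturbed:
  fixes A M :: "real^'n^'m"
  assumes "s * norm v \<le> norm (A *v v)" and "mat_norm (M - A) \<le> e"
  shows "(s - e) * norm v \<le> norm (M *v v)"
proof -
  have "norm ((M - A) *v v) \<le> e * norm v"
    using mat_norm_mult_vec_le[of "M - A" v] assms(2)
    by (meson mult_right_mono norm_ge_zero order_trans)
  moreover have "norm (A *v v) \<le> norm (M *v v) + norm ((M - A) *v v)"
    by (metis matrix_vector_mult_diff_rdistrib norm_triangle_sub norm_minus_commute)
  ultimately show ?thesis
    using assms(1) by (simp add: algebra_simps)
qed

text \<open>For \<open>r > 0\<close> the lower bound makes \<open>M\<close> injective, hence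
  surjective since it is square; the same bound at a preimage of \<open>d\<close> puts that preimage
  in the unit ball.\<close>

lemma mem_image_unit_ball:
  fixes M :: "real^'n^'n"
  assumes ge: "\<And>v. r * norm v \<le> norm (M *v v)" and d: "norm d \<le> r"
  shows "\<exists>u\<in>cball 0 1. M *v u = d"
proof (cases "r = 0")
  \<comment> \<open>here \<open>M\<close> may be singular\<close>
  case True
  then show ?thesis
    using d by (intro bexI[of _ 0]) auto
next
  case False
  with d have r: "0 < r"
    using norm_ge_zero[of d] by linarith
  have "v = 0" if "M *v v = 0" for v
    using ge[of v] r that by (simp add: mult_le_0_iff)
  then have "inj ((*v) M)"
    by (simp add: linear_injective_0)
  then have "surj ((*v) M)"
    by (simp add: linear_injective_imp_surjective)
  then obtain u where u: "M *v u = d"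
    by (metis surjD)
  have "r * norm u \<le> r * 1"
    using ge[of u] u d by simp
  with r have "norm u \<le> 1"
    by (simp only: mult_le_cancel_left_pos)
  with u show ?thesis by auto
qed

theorem theorem1:
  fixes f :: "real^'n \<Rightarrow> real^'n"
    and G :: "real^'n \<Rightarrow> real^'n^'n"
    and Lf LG :: real
    and x :: "real^'n"
  assumes "0 \<le> Lf" and "0 \<le> LG"
    and "Lf-lipschitz_on UNIV f"
    and "mat_lipschitz LG G"
    and "invertible (G 0)"
    and "(Lf + LG) * norm x \<le> inverse (mat_norm (matrix_inv (G 0)))"
  shows "guaranteed_velocity_ball Lf LG f G x \<subseteq> guaranteed_velocity_set Lf LG f G x"
proof -
  define s where "s = inverse (mat_norm (matrix_inv (G 0)))"
  have "y \<in> (\<lambda>u. f' x + G' x *v u) ` cball 0 1"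
    if y: "y \<in> guaranteed_velocity_ball Lf LG f G x" and D: "(f', G') \<in> D_con Lf LG f G"
    for y f' G'
  proof -
    have f': "f' 0 = f 0" "Lf-lipschitz_on UNIV f'" and G': "G' 0 = G 0" "mat_lipschitz LG G'"
      using D by (auto simp: D_con_def)
    have "mat_norm (G' x - G 0) \<le> LG * norm x"
      using G' by (metis mat_lipschitz_def diff_zero)
    then have ge: "(s - LG * norm x) * norm v \<le> norm (G' x *v v)" for v
      unfolding s_def using norm_mult_vec_ge_of_invertible[OF assms(5)]
      by (rule norm_mult_vec_ge_perturbed[rotated])
    have "dist (f 0) (f' x) \<le> Lf * norm x"
      using lipschitz_onD[OF f'(2), of 0 x] f'(1) by simp
    moreover have "dist (f 0) y \<le> s - Lf * norm x - LG * norm x"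
      using y by (simp add: guaranteed_velocity_ball_def s_def)
    \<comment> \<open>The term \<open>Lf * norm x\<close> taken off the radius pays for moving the
      centre from \<open>f 0\<close> to \<open>f' x\<close>.\<close>
    ultimately have "norm (y - f' x) \<le> s - LG * norm x"
      using dist_triangle3[of y "f' x" "f 0"] by (simp add: dist_norm)
    then obtain u where "u \<in> cball 0 1" "G' x *v u = y - f' x"
      using mem_image_unit_ball[OF ge] by blast
    then show ?thesis
      by (intro image_eqI[of _ _ u]) auto
  qed
  then show ?thesis
    by (auto simp: guaranteed_velocity_set_def)
qed

end
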